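(* Let $\alpha\in(0,1)$, let $\nu := (1+\alpha)^{-1}(\delta_0+\alpha\,\delta_1)$, where $\delta_a$ denotes the Dirac measure at $a\in\mathbb{R}$, let $\gamma_1(dx)=\frac{1}{\pi}\frac{1}{x^2+1}\,dx$ be the standard Cauchy distribution, and let $\mu:=\gamma_1*\nu$ be their convolution. Then $\mu$ is admissible, $\mu$ is not infinitely divisible, and $$\left[\frac{\sqrt{\alpha}}{1-\alpha},\infty\right)\subset\Lambda(\mu).$$ In particular, $\Lambda(\mu)$ has non-empty interior and $0<\lambda_1(\mu)<\infty$.
   Context: A characteristic function is a function $f:\mathbb{R}\to\mathbb{C}$ that is continuous, positive-definite, and satisfies $f(0)=1$; by Bochner's theorem these are exactly the Fourier transforms $\hat\mu(y)=\int_{\mathbb{R}}e^{iyx}\,\mu(dx)$ of probability measures $\mu$ on $\mathbb{R}$. A probability measure $\mu$ on $\mathbb{R}$ is called admissible if $\hat\mu(y)\neq 0$ for all $y\in\mathbb{R}$. For an admissible $\mu$ there is a unique continuous function $\psi:\mathbb{R}\to\mathbb{C}$ with $\psi(0)=0$ and $\hat\mu=e^{\psi}$, called the second characteristic of $\mu$. For an admissible $\mu$ with second characteristic $\psi$ one sets $\Lambda(\mu):=\{t>0 : e^{t\psi}\text{ is a characteristic function}\}$. Moreover, $\lambda_1(\mu):=\infty$ if the interior of $\Lambda(\mu)$ is empty, and $\lambda_1(\mu):=\inf\{\lambda>0:\Lambda(\mu)\supset[\lambda,\infty)\}$ otherwise. An admissible $\mu$ is infinitely divisible if for every integer $n\geq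 1$ it is the $n$-fold convolution of some probability measure with itself (equivalently, by Schoenberg's theorem, $\Lambda(\mu)=(0,\infty)$). *)

theory Defs
  imports "HOL-Probability.Probability"
begin

definition positive_definite :: "(real \<Rightarrow> complex) \<Rightarrow> bool" where
  "positive_definite f \<longleftrightarrow>
     (\<forall>(n::nat) (y::nat \<Rightarrow> real) (z::nat \<Rightarrow> complex).
        (\<Sum>i<n. \<Sum>j<n. f (y i - y j) * z i * cnj (z j)) \<in> \<real> \<and>
        0 \<le> Re (\<Sum>i<n. \<Sum>j<n. f (y i - y j) * z i * cnj (z j)))"

definition characteristic_function :: "(real \<Rightarrow> complex) \<Rightarrow> bool" where
  "characteristic_function f \<longleftrightarrow>
     continuous_on UNIV f \<and> positive_definite f \<and> f 0 = 1"

text \<open>Probability measures on the real line are rendered by the library locale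
  \<^locale>\<open>real_distribution\<close> and their Fourier transforms by \<^const>\<open>char\<close>.\<close>

definition admissible :: "real measure \<Rightarrow> bool" where
  "admissible M \<longleftrightarrow> real_distribution M \<and> (\<forall>y. char M y \<noteq> 0)"

definition second_characteristic :: "real measure \<Rightarrow> real \<Rightarrow> complex" where
  "second_characteristic M =
     (THE \<psi>. continuous_on UNIV \<psi> \<and> \<psi> 0 = 0 \<and> (\<forall>y. char M y = exp (\<psi> y)))"

lemma ex1_second_characteristic:
  assumes "admissible M"
  shows "\<exists>!\<psi>. continuous_on UNIV \<psi> \<and> \<psi> 0 = 0 \<and> (\<forall>y. char M y = exp (\<psi> y))"
proof -
  interpret real_distribution M using assms by (simp add: admissible_def)
  have c: "continuous_on UNIV (char M)"
    by (intro continuous_at_imp_continuous_on ballI isCont_char)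
  obtain g where g: "continuous_on UNIV g" "\<And>y. char M y = exp (g y)"
    using continuous_logarithm_on_contractible[OF c] assms
    by (auto simp: admissible_def convex_imp_contractible)
  have e0: "exp (g 0) = 1" using g(2)[of 0] char_zero by simp
  show ?thesis
  proof (rule ex1I[of _ "\<lambda>y. g y - g 0"])
    show "continuous_on UNIV (\<lambda>y. g y - g 0) \<and> g 0 - g 0 = 0 \<and> (\<forall>y. char M y = exp (g y - g 0))"
      using g e0 by (auto simp: exp_diff intro!: continuous_intros)
  next
    fix h assume h: "continuous_on UNIV h \<and> h 0 = 0 \<and> (\<forall>y. char M y = exp (h y))"
    define d where "d y = h y - (g y - g 0)" for y
    have ed: "exp (d y) = 1" for y
      using h g(2)[of y] e0 by (simp add: d_def exp_diff)
    have cd: "continuous_on UNIV d" unfolding d_def using h g by (auto intro!: continuous_intros)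
    have gap: "\<exists>e>0. \<forall>y. y \<in> UNIV \<and> d y \<noteq> d x \<longrightarrow> e \<le> norm (d y - d x)" if "x \<in> UNIV" for x
    proof (intro exI[of _ "2*pi"] conjI allI impI)
      fix y assume ne: "y \<in> UNIV \<and> d y \<noteq> d x"
      have "exp (d y) = exp (d x)" using ed by simp
      then obtain n :: int where n: "d y = d x + (of_int (2 * n) * pi) * \<i>" by (auto simp: exp_eq)
      have "n \<noteq> 0" using n ne by auto
      hence "1 \<le> \<bar>real_of_int n\<bar>" by linarith
      moreover have "norm (d y - d x) = 2 * pi * \<bar>real_of_int n\<bar>"
        using n by (simp add: norm_mult)
      ultimately show "2 * pi \<le> norm (d y - d x)" using pi_gt_zero by simp
    qed simp
    have "d constant_on UNIV"
      by (rule continuous_discrete_range_constant[OF _ cd gap]) auto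
    moreover have "d 0 = 0" using h by (simp add: d_def)
    ultimately have "d y = 0" for y by (metis UNIV_I constant_on_def)
    thus "h = (\<lambda>y. g y - g 0)" by (auto simp: d_def)
  qed
qed

definition Lambda :: "real measure \<Rightarrow> real set" where
  "Lambda M = {t. t > 0 \<and>
     characteristic_function (\<lambda>y. exp (complex_of_real t * second_characteristic M y))}"

text \<open>The infimum is taken in the extended reals, so that the infimum of the empty set is \<open>\<infinity>\<close>.\<close>

definition lambda1 :: "real measure \<Rightarrow> ereal" where
  "lambda1 M = (if interior (Lambda M) = {} then \<infinity>
     else Inf (ereal ` {l. l > 0 \<and> {l..} \<subseteq> Lambda M}))"

primrec convolution_power :: "real measure \<Rightarrow> nat \<Rightarrow> real measure" where
  "convolution_power M 0 = return borel 0"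
| "convolution_power M (Suc n) = convolution M (convolution_power M n)"

definition infinitely_divisible :: "real measure \<Rightarrow> bool" where
  "infinitely_divisible M \<longleftrightarrow>
     (\<forall>n\<ge>1. \<exists>N. real_distribution N \<and> M = convolution_power N n)"

definition add_measure :: "'a measure \<Rightarrow> 'a measure \<Rightarrow> 'a measure" where
  "add_measure M N = measure_of (space M) (sets M) (\<lambda>A. emeasure M A + emeasure N A)"

lemma space_add_measure [simp]: "space (add_measure M N) = space M"
  and sets_add_measure [simp, measurable_cong]: "sets (add_measure M N) = sets M"
  by (auto simp: add_measure_def)

lemma emeasure_add_measure:
  assumes "sets N = sets M" "A \<in> sets M"
  shows "emeasure (add_measure M N) A = emeasure M A + emeasure N A"
proof (rule emeasure_measure_of[OF add_measure_def])
  show "countably_additive (sets (add_measure M N)) (\<lambda>A. emeasure M A + emeasure N A)"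
    using assms by (auto simp: countably_additive_def suminf_add[symmetric] suminf_emeasure)
qed (use assms sets.space_closed in \<open>auto simp: positive_def\<close>)

definition two_point_measure :: "real \<Rightarrow> real measure" where
  "two_point_measure \<alpha> = scale_measure (ennreal (1 / (1 + \<alpha>)))
     (add_measure (return borel 0) (scale_measure (ennreal \<alpha>) (return borel 1)))"

definition standard_cauchy :: "real measure" where
  "standard_cauchy = density lborel (\<lambda>x. ennreal (1 / pi * (1 / (x\<^sup>2 + 1))))"

lemma real_distribution_two_point_measure:
  assumes "0 < \<alpha>"
  shows "real_distribution (two_point_measure \<alpha>)"
proof (rule real_distribution.intro)
  show "prob_space (two_point_measure \<alpha>)"
  proof
    show "emeasure (two_point_measure \<alpha>) (space (two_point_measure \<alpha>)) = 1"
      using assms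
      by (simp add: two_point_measure_def space_scale_measure emeasure_add_measure
          flip: ennreal_mult ennreal_1 ennreal_plus)
  qed
  show "real_distribution_axioms (two_point_measure \<alpha>)"
    by (simp add: real_distribution_axioms_def two_point_measure_def)
qed

end

theory Submission
  imports Defs
begin

text \<open>
  The Cauchy factor of \<open>\<mu>\<close> has Fourier transform \<open>exp (-|y|)\<close>, so the second characteristic is
  \<open>\<psi> y = Ln (1 + \<alpha> exp (iy)) - ln (1 + \<alpha>) - |y|\<close>; the principal branch serves because
  \<open>1 + \<alpha> exp (iy)\<close> has positive real part.

  For \<open>t > 0\<close> the binomial series turns \<open>exp (t \<psi>)\<close> into the Fourier transform of
  \<open>g x = (1 + \<alpha>) powr (-t) * (\<Sum>k. (t gchoose k) * \<alpha> ^ k * p (x - k))\<close>, where \<open>p\<close> is the Cauchy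
  density of scale \<open>t\<close>. It remains to see that \<open>g \<ge> 0\<close> once \<open>t \<ge> sqrt \<alpha> / (1 - \<alpha>)\<close>
  (\<open>binomial_cauchy_mixture_nonneg\<close>). The binomial coefficients are nonnegative up to index
  \<open>floor t + 1\<close>; from there on they alternate in sign with decreasing modulus. The condition on
  \<open>t\<close> says exactly that \<open>\<alpha> * p (x - 1) \<le> p x\<close> for all \<open>x\<close> (\<open>cauchy_density_shift_le\<close>), so the tail
  of the series is an alternating series with decreasing terms and a nonnegative first term.

  On the other hand some \<open>1 / n\<close> lies outside \<open>\<Lambda>(\<mu>)\<close> (\<open>ex_inverse_notin_Lambda\<close>). Otherwise,
  differentiating \<open>exp (t \<psi>)\<close> at \<open>t = 0\<close> along \<open>t = 1 / n\<close> shows that \<open>\<psi>\<close> is conditionally positive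
  definite, that is, \<open>\<Sum>i j. \<psi> (y i - y j) * z i * cnj (z j) \<ge> 0\<close> whenever \<open>\<Sum>i. z i = 0\<close>. Take the \<open>4M\<close>
  points \<open>y j = j pi / 2\<close> with weights \<open>z j = (-1) ^ j\<close>. This frequency picks out the negative
  coefficients of \<open>Ln (1 + \<alpha> exp (iy)) = \<Sum>k. (-1) ^ (k + 1) * \<alpha> ^ k / k * exp (iky)\<close> at
  \<open>k = 2, 6, 10, ...\<close>, and the real part of the form equals
  \<open>4 M\<^sup>2 ln ((1 - \<alpha>\<^sup>2) / (1 + \<alpha>\<^sup>2)) + 2 pi M\<close>, which is negative for large \<open>M\<close>.
  Such an \<open>n\<close> makes \<open>\<lambda>\<^sub>1(\<mu>) \<ge> 1 / n\<close>, and it precludes infinite divisibility because an \<open>n\<close>-th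
  convolution root of \<open>\<mu>\<close> would have the characteristic function \<open>exp (\<psi> / n)\<close>.
\<close>

section \<open>Characteristic functions of measures\<close>

lemma real_distribution_convolution:
  assumes "real_distribution M" "real_distribution N"
  shows "real_distribution (M \<star> N)"
proof -
  interpret M: real_distribution M by fact
  interpret N: real_distribution N by fact
  interpret P: pair_prob_space M N ..
  have "prob_space (M \<star> N)"
    unfolding convolution_def by (rule P.prob_space_distr) simp
  thus ?thesis by (simp add: real_distribution_def real_distribution_axioms_def)
qed

lemma char_convolution:
  assumes "real_distribution M" "real_distribution N"
  shows "char (M \<star> N) t = char M t * char N t"
proof -
  interpret M: real_distribution M by fact
  interpret N: real_distribution N by fact
  interpret P: pair_prob_space M N ..
  have int: "integrable (M \<Otimes>\<^sub>M N) (\<lambda>(x, y). iexp (t * x) * iexp (t * y))"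
    by (rule P.integrable_const_bound[where B=1]) (auto simp: norm_mult)
  have "char (M \<star> N) t = (CLINT p|M \<Otimes>\<^sub>M N. (case p of (x, y) \<Rightarrow> iexp (t * x) * iexp (t * y)))"
    by (simp add: char_def convolution_def integral_distr split_def exp_add distrib_left)
  also have "\<dots> = (CLINT x|M. CLINT y|N. iexp (t * x) * iexp (t * y))"
    using P.integral_fst[OF int] by simp
  also have "\<dots> = char M t * char N t"
    by (simp add: char_def)
  finally show ?thesis .
qed

lemma real_distribution_convolution_power:
  assumes "real_distribution N"
  shows "real_distribution (convolution_power N n)"
proof (induction n)
  case 0
  show ?case by (auto simp: real_distribution_def real_distribution_axioms_def intro!: prob_space_return)
qed (auto intro: real_distribution_convolution assms)

lemma char_convolution_power:
  assumes "real_distribution N"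
  shows "char (convolution_power N n) t = char N t ^ n"
proof (induction n)
  case 0
  show ?case by (simp add: char_def integral_return)
next
  case (Suc n)
  thus ?case
    by (simp add: char_convolution[OF assms real_distribution_convolution_power[OF assms]])
qed

text \<open>The easy half of Bochner's theorem: the quadratic form is the integral of
  \<open>|\<Sum>i. z i * exp (i y i x)|\<^sup>2\<close>.\<close>

lemma characteristic_function_char:
  assumes "real_distribution M"
  shows "characteristic_function (char M)"
proof -
  interpret real_distribution M by fact
  have "(\<Sum>i<n. \<Sum>j<n. char M (y i - y j) * z i * cnj (z j))
      = of_real (LINT x|M. (cmod (\<Sum>i<n. z i * iexp (y i * x)))\<^sup>2)" (is "?L = of_real ?R")
    for n :: nat and y :: "nat \<Rightarrow> real" and z :: "nat \<Rightarrow> complex"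
  proof -
    have int: "integrable M (\<lambda>x. iexp (c * x))" for c
      by (rule integrable_iexp) auto
    have "?L = (\<Sum>i<n. \<Sum>j<n. CLINT x|M. iexp ((y i - y j) * x) * z i * cnj (z j))"
      using int by (simp add: char_def)
    also have "\<dots> = (CLINT x|M. (\<Sum>i<n. \<Sum>j<n. iexp ((y i - y j) * x) * z i * cnj (z j)))"
      using int by (simp add: Bochner_Integration.integral_sum del: of_real_mult of_real_diff)
    also have "\<dots> = (CLINT x|M. of_real ((cmod (\<Sum>i<n. z i * iexp (y i * x)))\<^sup>2))"
    proof (rule Bochner_Integration.integral_cong)
      fix x
      have "iexp ((a - b) * x) = iexp (a * x) * cnj (iexp (b * x))" for a b
        by (simp add: exp_cnj flip: exp_add) (simp add: algebra_simps)
      thus "(\<Sum>i<n. \<Sum>j<n. iexp ((y i - y j) * x) * z i * cnj (z j))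
          = of_real ((cmod (\<Sum>i<n. z i * iexp (y i * x)))\<^sup>2)"
        unfolding complex_norm_square
        by (simp add: sum_product mult_ac)
    qed simp
    finally show ?thesis by (simp only: integral_complex_of_real)
  qed
  hence "positive_definite (char M)"
    by (auto simp: positive_definite_def intro!: integral_nonneg)
  thus ?thesis
    by (auto simp: characteristic_function_def char_zero intro!: continuous_at_imp_continuous_on isCont_char)
qed

text \<open>Nonnegativity of an integrable \<open>g\<close> and \<open>f 0 = 1\<close> make the Fourier transform \<open>f\<close> of \<open>g\<close> a
  characteristic function.\<close>

lemma characteristic_function_of_density:
  assumes [measurable]: "g \<in> borel_measurable borel" and g0: "\<And>x. 0 \<le> g x"
    and four: "\<And>y. has_bochner_integral lborel (\<lambda>x. complex_of_real (g x) * iexp (y * x)) (f y)"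
    and f0: "f 0 = 1"
  shows "real_distribution (density lborel g)" "char (density lborel g) = f"
    "characteristic_function f"
proof -
  have "has_bochner_integral lborel (\<lambda>x. complex_of_real (g x)) (of_real 1)"
    using four[of 0] f0 by simp
  hence "has_bochner_integral lborel g 1"
    by (simp only: has_bochner_integral_iff complex_of_real_integrable_eq integral_complex_of_real of_real_eq_iff)
  hence "emeasure (density lborel g) (space (density lborel g)) = 1"
    using g0 by (simp add: emeasure_density nn_integral_eq_integral has_bochner_integral_iff)
  thus r: "real_distribution (density lborel g)"
    by (auto simp: real_distribution_def real_distribution_axioms_def intro!: prob_spaceI)
  show c: "char (density lborel g) = f"
  proof
    fix y
    show "char (density lborel g) y = f y"
      unfolding char_def using g0 four[of y]
      by (subst integral_density) (auto simp: has_bochner_integral_iff scaleR_conv_of_real)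
  qed
  show "characteristic_function f"
    using characteristic_function_char[OF r] c by simp
qed

text \<open>The second characteristic of an \<open>n\<close>-th convolution root is the \<open>n\<close>-th part of the second
  characteristic, by uniqueness of the latter.\<close>

lemma inverse_in_Lambda_of_convolution_root:
  assumes M: "admissible M" and N: "real_distribution N" and n: "n \<ge> 1"
    and eq: "M = convolution_power N n"
  shows "1 / real n \<in> Lambda M"
proof -
  have ch: "char M y = char N y ^ n" for y
    using char_convolution_power[OF N] by (simp add: eq)
  have "admissible N"
    using M N n by (auto simp: admissible_def ch)
  from ex1_second_characteristic[OF this] obtain \<phi> where
    \<phi>: "continuous_on UNIV \<phi>" "\<phi> 0 = 0" "\<And>y. char N y = exp (\<phi> y)" by blast
  have "second_characteristic M = (\<lambda>y. of_nat n * \<phi> y)"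
    unfolding second_characteristic_def
    by (rule the1_equality[OF ex1_second_characteristic[OF M]])
      (auto simp: ch \<phi> exp_of_nat_mult intro!: continuous_intros)
  hence "(\<lambda>y. exp (complex_of_real (1 / real n) * second_characteristic M y)) = char N"
    using n \<phi>(3) by (auto simp: fun_eq_iff)
  thus ?thesis
    using characteristic_function_char[OF N] n by (simp add: Lambda_def)
qed

section \<open>The Fourier transform of the Cauchy density\<close>

text \<open>The Fourier transform of the Laplace density is, up to scaling, the Cauchy density. The integral
  over the line is the sum of the integrals of \<open>exp ((-1 + ix) u)\<close> and \<open>exp ((-1 - ix) u)\<close> over the
  half-line \<open>u > 0\<close>.\<close>

lemma fourier_exp_neg_abs:
  "has_bochner_integral lborel (\<lambda>u. complex_of_real (exp (- \<bar>u\<bar>)) * iexp (x * u))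
     (complex_of_real (2 / (1 + x\<^sup>2)))"
proof -
  define h where "h x u = exp ((-1 + \<i> * complex_of_real x) * complex_of_real u)" for x u :: real
  have nz: "-1 + \<i> * complex_of_real x \<noteq> 0" for x
    by (auto simp: complex_eq_iff)
  have nh: "norm (h x u) = exp (- u)" for x u
    by (simp add: h_def)
  have ei: "einterval 0 \<infinity> = {0<..}"
    by (auto simp: einterval_def)
  have int: "set_integrable lborel (einterval 0 \<infinity>) (h x)" for x
  proof (rule set_integrable_bound[of _ _ "\<lambda>u. exp (- u)"])
    show "set_integrable lborel (einterval 0 \<infinity>) (\<lambda>u. exp (- u))"
      using integrable_I0i_exp_mscale[of 1] by (simp add: ei)
    show "set_borel_measurable lborel (einterval 0 \<infinity>) (h x)"
      by (simp add: set_borel_measurable_def h_def)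
  qed (simp add: nh)
  have half: "has_bochner_integral lborel (\<lambda>u. indicator {0<..} u *\<^sub>R h x u)
      (1 / (1 - \<i> * complex_of_real x))" for x
  proof -
    let ?F = "\<lambda>u. h x u / (-1 + \<i> * complex_of_real x)"
    have "(LBINT u=0..\<infinity>. h x u) = 0 - 1 / (-1 + \<i> * complex_of_real x)"
    proof (rule interval_integral_FTC_integrable[where F = ?F])
      show "(?F has_vector_derivative h x u) (at u)" for u
      proof -
        let ?c = "-1 + \<i> * complex_of_real x"
        have "((\<lambda>z. exp (?c * z) / ?c) has_field_derivative exp (?c * of_real u)) (at (of_real u))"
          using nz[of x] by (intro derivative_eq_intros refl | simp)+
        from has_vector_derivative_real_field[OF this] show ?thesis by (simp only: h_def)
      qed
      show "isCont (h x) u" for u unfolding h_def by (intro continuous_intros)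
      show "((?F \<circ> real_of_ereal) \<longlongrightarrow> 1 / (-1 + \<i> * complex_of_real x)) (at_right 0)"
        unfolding zero_ereal_def ereal_tendsto_simps h_def using nz
        by (auto intro!: tendsto_eq_intros)
      have "((\<lambda>u. norm (h x u)) \<longlongrightarrow> 0) at_top"
        unfolding nh by (intro filterlim_compose[OF exp_at_bot]) (simp add: filterlim_uminus_at_bot filterlim_ident)
      hence "((\<lambda>u. h x u / (-1 + \<i> * complex_of_real x)) \<longlongrightarrow> 0 / (-1 + \<i> * complex_of_real x)) at_top"
        using nz by (intro tendsto_divide tendsto_const) (auto simp: tendsto_norm_zero_iff)
      thus "((?F \<circ> real_of_ereal) \<longlongrightarrow> 0) (at_left \<infinity>)"
        unfolding ereal_tendsto_simps by (simp add: o_def)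
    qed (use int in auto)
    also have "\<dots> = 1 / (1 - \<i> * complex_of_real x)"
      by (metis minus_diff_eq minus_divide_right diff_0 uminus_add_conv_diff)
    finally show ?thesis
      using int[of x]
      by (simp add: has_bochner_integral_iff interval_lebesgue_integral_0_infty set_lebesgue_integral_def
          set_integrable_def ei)
  qed
  have refl: "has_bochner_integral lborel (\<lambda>u. indicator {0<..} (-u) *\<^sub>R h (-x) (-u))
      (1 / (1 + \<i> * complex_of_real x))"
    using half[of "-x"] by (subst (asm) lborel_has_bochner_integral_real_affine_iff[where c="-1" and t=0]) auto
  have "has_bochner_integral lborel
      (\<lambda>u. indicator {0<..} u *\<^sub>R h x u + indicator {0<..} (-u) *\<^sub>R h (-x) (-u))
      (1 / (1 - \<i> * complex_of_real x) + 1 / (1 + \<i> * complex_of_real x))"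
    by (intro has_bochner_integral_add half refl)
  also have "1 / (1 - \<i> * complex_of_real x) + 1 / (1 + \<i> * complex_of_real x) = complex_of_real (2 / (1 + x\<^sup>2))"
  proof -
    have "1 - \<i> * complex_of_real x \<noteq> 0" "1 + \<i> * complex_of_real x \<noteq> 0" by (auto simp: complex_eq_iff)
    moreover have "(1 - \<i> * complex_of_real x) * (1 + \<i> * complex_of_real x) = of_real (1 + x\<^sup>2)"
      by (simp add: algebra_simps power2_eq_square)
    ultimately show ?thesis by (simp add: add_divide_eq_iff divide_add_eq_iff)
  qed
  finally show ?thesis
  proof (rule has_bochner_integral_cong_AE[THEN iffD1, rotated -1])
    show "AE u in lborel. indicator {0<..} u *\<^sub>R h x u + indicator {0<..} (-u) *\<^sub>R h (-x) (-u)
        = complex_of_real (exp (- \<bar>u\<bar>)) * iexp (x * u)"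
      using AE_lborel_singleton[of 0]
      by eventually_elim
        (auto simp: h_def indicator_def not_less algebra_simps exp_add exp_diff exp_minus exp_of_real
           divide_inverse)
  qed (auto simp: h_def)
qed

text \<open>Parseval's relation between two distributions, by Fubini.\<close>

lemma parseval_char:
  assumes "real_distribution M" "real_distribution N"
  shows "(CLINT z|N. char M (s * z) * iexp (s * y * z)) = (CLINT u|M. char N (s * (u + y)))"
proof -
  interpret M: real_distribution M by fact
  interpret N: real_distribution N by fact
  interpret P: pair_prob_space M N ..
  have int: "integrable (M \<Otimes>\<^sub>M N) (\<lambda>(u, z). iexp (s * (u + y) * z))"
    by (rule P.integrable_const_bound[where B=1]) auto
  have "(CLINT z|N. char M (s * z) * iexp (s * y * z)) = (CLINT z|N. CLINT u|M. iexp (s * (u + y) * z))"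
    by (simp add: char_def flip: integral_mult_left_zero) (simp add: algebra_simps exp_add)
  also have "\<dots> = (CLINT u|M. CLINT z|N. iexp (s * (u + y) * z))"
    by (rule P.Fubini_integral[OF int])
  finally show ?thesis
    by (simp add: char_def)
qed

lemma integrable_inverse_one_plus_square: "integrable lborel (\<lambda>x::real. 1 / (1 + x\<^sup>2))"
  using integrable_inverse_1_plus_square by (simp add: set_integrable_def inverse_eq_divide)

text \<open>Fourier inversion for the Laplace density \<open>L\<close>. The transform \<open>F\<close> of \<open>L\<close> is damped by a
  Gaussian factor of width \<open>s\<close>; Parseval's relation turns the inversion integral into
  a Gaussian average of \<open>L\<close>, which concentrates at \<open>-y\<close> as \<open>s\<close> tends to infinity.\<close>

lemma fourier_inverse_one_plus_square:
  "(CLINT x|lborel. complex_of_real (1 / (1 + x\<^sup>2)) * iexp (y * x)) = of_real (pi * exp (- \<bar>y\<bar>))"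
proof -
  define L where "L u = exp (- \<bar>u\<bar>) / 2" for u :: real
  define F where "F x = 1 / (1 + x\<^sup>2)" for x :: real
  have Lpos: "L u \<ge> 0" for u by (simp add: L_def)
  have L1: "L u \<le> 1" for u
  proof -
    have "exp (- \<bar>u\<bar>) \<le> 1" by simp
    thus ?thesis unfolding L_def by linarith
  qed
  have F0: "F x \<ge> 0" for x by (simp add: F_def)
  have [measurable]: "L \<in> borel_measurable borel" "F \<in> borel_measurable borel"
    by (auto simp: L_def[abs_def] F_def[abs_def])
  have intF: "integrable lborel F"
    using integrable_inverse_one_plus_square by (simp add: F_def[abs_def])
  define U where "U = density lborel (\<lambda>u. ennreal (L u))"
  have fourier_L: "has_bochner_integral lborel (\<lambda>u. L u *\<^sub>R iexp (x * u)) (of_real (F x))" for x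
    using has_bochner_integral_mult_right[OF fourier_exp_neg_abs[of x], of "1/2"]
    by (simp add: L_def F_def scaleR_conv_of_real mult_ac)
  have char_U: "char U x = of_real (F x)" for x
    unfolding char_def U_def using fourier_L[of x] Lpos
    by (subst integral_density) (auto simp: has_bochner_integral_iff)
  have U: "real_distribution U"
  proof -
    have "has_bochner_integral lborel (\<lambda>u. complex_of_real (L u)) (complex_of_real 1)"
      using fourier_L[of 0] by (simp add: F_def scaleR_conv_of_real)
    hence "has_bochner_integral lborel L 1"
      by (simp only: has_bochner_integral_iff complex_of_real_integrable_eq integral_complex_of_real of_real_eq_iff)
    hence "emeasure U (space U) = 1"
      using Lpos by (simp add: U_def emeasure_density nn_integral_eq_integral has_bochner_integral_iff)
    thus ?thesis
      by (auto simp: real_distribution_def real_distribution_axioms_def U_def intro!: prob_spaceI)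
  qed
  let ?Z = "density lborel std_normal_density"
  \<comment> \<open>Parseval's relation, with both variables rescaled so that both integrals converge as
    \<open>s\<close> tends to infinity.\<close>
  have eq: "(CLINT x|lborel. std_normal_density (x / s) *\<^sub>R (of_real (F x) * iexp (y * x)))
      = (CLINT v|lborel. (sqrt (2 * pi) * std_normal_density v * L (v / s - y)) *\<^sub>R 1)"
    (is "?l = ?r") if s: "s > 0" for s :: real
  proof -
    have "(1 / s) *\<^sub>R ?l = (CLINT z|?Z. char U (s * z) * iexp (s * y * z))"
      using s
      by (subst lborel_integral_real_affine[where c = s and t = 0])
        (auto simp: integral_density char_U mult_ac)
    also have "\<dots> = (CLINT u|U. char ?Z (s * (u + y)))"
      by (rule parseval_char[OF U real_dist_normal_dist])
    also have "\<dots> = (CLINT u|lborel. L u *\<^sub>R of_real (exp (- (s * (u + y))\<^sup>2 / 2)))"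
      using Lpos by (simp add: U_def integral_density char_std_normal_distribution del: integral_complex_of_real)
    also have "\<dots> = (1 / s) *\<^sub>R ?r"
      using s
      by (subst lborel_integral_real_affine[where c = "1/s" and t = "-y"])
        (auto simp: normal_density_def scaleR_conv_of_real mult_ac)
    finally show ?thesis using s by simp
  qed
  have "(\<lambda>n. CLINT x|lborel. std_normal_density (x / Suc n) *\<^sub>R (of_real (F x) * iexp (y * x)))
    \<longlonglongrightarrow> (CLINT x|lborel. std_normal_density 0 *\<^sub>R (of_real (F x) * iexp (y * x)))" (is "?a \<longlonglongrightarrow> ?A")
  proof (rule integral_dominated_convergence[where w = F])
    show "AE x in lborel. (\<lambda>n. std_normal_density (x / Suc n) *\<^sub>R (of_real (F x) * iexp (y * x)))
        \<longlonglongrightarrow> std_normal_density 0 *\<^sub>R (of_real (F x) * iexp (y * x))"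
      unfolding normal_density_def
      by (intro AE_I2 tendsto_intros tendsto_divide_0[OF tendsto_const] filterlim_real_sequentially
          filterlim_at_top_imp_at_infinity filterlim_compose[OF filterlim_real_sequentially filterlim_Suc]) auto
    show "AE x in lborel. norm (std_normal_density (x / Suc n) *\<^sub>R (of_real (F x) * iexp (y * x))) \<le> F x" for n
    proof (rule AE_I2)
      fix x :: real
      have "std_normal_density (x / Suc n) \<le> 1 / sqrt (2 * pi)"
        by (simp add: normal_density_def divide_right_mono)
      also have "\<dots> \<le> 1" using pi_ge_two by simp
      finally show "norm (std_normal_density (x / Suc n) *\<^sub>R (of_real (F x) * iexp (y * x))) \<le> F x"
        using F0[of x] by (simp add: norm_mult mult_left_le_one_le)
    qed
  qed (use intF in auto)
  moreover have "(\<lambda>n. CLINT v|lborel. (sqrt (2 * pi) * std_normal_density v * L (v / Suc n - y)) *\<^sub>R 1)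
    \<longlonglongrightarrow> (CLINT v|lborel. (sqrt (2 * pi) * std_normal_density v * L (0 - y)) *\<^sub>R 1)" (is "_ \<longlonglongrightarrow> ?B")
  proof (rule integral_dominated_convergence[where w = "\<lambda>v. sqrt (2 * pi) * std_normal_density v"])
    show "AE v in lborel. (\<lambda>n. (sqrt (2 * pi) * std_normal_density v * L (v / Suc n - y)) *\<^sub>R (1::complex))
        \<longlonglongrightarrow> (sqrt (2 * pi) * std_normal_density v * L (0 - y)) *\<^sub>R 1"
      unfolding L_def
      by (intro AE_I2 tendsto_intros tendsto_divide_0[OF tendsto_const]
          filterlim_at_top_imp_at_infinity filterlim_compose[OF filterlim_real_sequentially filterlim_Suc]) auto
    show "AE v in lborel. norm ((sqrt (2 * pi) * std_normal_density v * L (v / Suc n - y)) *\<^sub>R (1::complex))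
        \<le> sqrt (2 * pi) * std_normal_density v" for n
      using Lpos L1 by (auto simp: abs_mult mult_left_le)
  qed (auto intro!: integrable_mult_right)
  ultimately have "?A = ?B"
    using eq[of "real (Suc n)" for n] by (simp add: LIMSEQ_unique)
  also have "?A = (1 / sqrt (2 * pi)) *\<^sub>R (CLINT x|lborel. of_real (F x) * iexp (y * x))"
    by (simp add: normal_density_def)
  also have "?B = of_real (sqrt (2 * pi) * L y)"
    by (simp add: L_def scaleR_conv_of_real)
  finally have "(CLINT x|lborel. of_real (F x) * iexp (y * x)) = sqrt (2 * pi) *\<^sub>R of_real (sqrt (2 * pi) * L y)"
    by (simp add: scaleR_conv_of_real field_simps)
  also have "\<dots> = of_real (pi * exp (- \<bar>y\<bar>))"
  proof -
    have "sqrt (2 * pi) * (sqrt (2 * pi) * L y) = pi * exp (- \<bar>y\<bar>)"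
      by (simp add: L_def flip: mult.assoc)
    thus ?thesis by (simp only: scaleR_conv_of_real flip: of_real_mult)
  qed
  finally show ?thesis by (simp add: F_def)
qed

text \<open>The density of the centred Cauchy distribution of scale \<open>t\<close>.\<close>

definition cauchy_density :: "real \<Rightarrow> real \<Rightarrow> real" where
  "cauchy_density t x = t / (pi * (x\<^sup>2 + t\<^sup>2))"

lemma cauchy_density_measurable [measurable]: "cauchy_density t \<in> borel_measurable borel"
  by (simp add: cauchy_density_def[abs_def])

lemma cauchy_density_nonneg: "t > 0 \<Longrightarrow> 0 \<le> cauchy_density t x"
  by (simp add: cauchy_density_def)

lemma fourier_cauchy_density:
  assumes t: "t > 0"
  shows "has_bochner_integral lborel (\<lambda>x. complex_of_real (cauchy_density t (x - a)) * iexp (y * x))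
    (iexp (y * a) * of_real (exp (- t * \<bar>y\<bar>)))"
proof -
  have "has_bochner_integral lborel (\<lambda>x. complex_of_real (1 / (1 + x\<^sup>2)) * iexp (t * y * x))
      (of_real (pi * exp (- \<bar>t * y\<bar>)))"
    unfolding has_bochner_integral_iff
  proof
    show "integrable lborel (\<lambda>x. complex_of_real (1 / (1 + x\<^sup>2)) * iexp (t * y * x))"
      by (rule Bochner_Integration.integrable_bound[OF integrable_inverse_one_plus_square])
        (auto simp: norm_mult norm_divide simp flip: of_real_add of_real_power)
  qed (rule fourier_inverse_one_plus_square)
  hence "has_bochner_integral lborel
      (\<lambda>x. complex_of_real (1 / (1 + (- (a / t) + 1 / t * x)\<^sup>2)) * iexp (t * y * (- (a / t) + 1 / t * x)))
      (of_real (pi * exp (- \<bar>t * y\<bar>)) /\<^sub>R \<bar>1 / t\<bar>)"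
    using t by (subst (asm) lborel_has_bochner_integral_real_affine_iff[where c = "1/t" and t = "- (a / t)"]) auto
  hence "has_bochner_integral lborel
      (\<lambda>x. iexp (y * a) / of_real (t * pi) *
        (complex_of_real (1 / (1 + (- (a / t) + 1 / t * x)\<^sup>2)) * iexp (t * y * (- (a / t) + 1 / t * x))))
      (iexp (y * a) / of_real (t * pi) * (of_real (pi * exp (- \<bar>t * y\<bar>)) /\<^sub>R \<bar>1 / t\<bar>))"
    by (rule has_bochner_integral_mult_right)
  also have "iexp (y * a) / of_real (t * pi) * (of_real (pi * exp (- \<bar>t * y\<bar>)) /\<^sub>R \<bar>1 / t\<bar>)
      = iexp (y * a) * of_real (exp (- t * \<bar>y\<bar>))"
    using t by (simp add: scaleR_conv_of_real abs_mult)
  also have "(\<lambda>x. iexp (y * a) / of_real (t * pi) *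
        (complex_of_real (1 / (1 + (- (a / t) + 1 / t * x)\<^sup>2)) * iexp (t * y * (- (a / t) + 1 / t * x))))
     = (\<lambda>x. complex_of_real (cauchy_density t (x - a)) * iexp (y * x))"
  proof
    fix x
    have 1: "t * y * (- (a / t) + 1 / t * x) = y * x - y * a"
      using t by (simp add: field_simps)
    have 2: "1 / (1 + (- (a / t) + 1 / t * x)\<^sup>2) = t * pi * cauchy_density t (x - a)"
    proof -
      have "1 + (- (a / t) + 1 / t * x)\<^sup>2 = ((x - a)\<^sup>2 + t\<^sup>2) / t\<^sup>2"
        using t by (simp add: field_simps power2_eq_square)
      thus ?thesis using t by (simp add: cauchy_density_def power2_eq_square)
    qed
    show "iexp (y * a) / of_real (t * pi) *
        (complex_of_real (1 / (1 + (- (a / t) + 1 / t * x)\<^sup>2)) * iexp (t * y * (- (a / t) + 1 / t * x)))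
     = complex_of_real (cauchy_density t (x - a)) * iexp (y * x)"
      unfolding 1 2 using t by (simp add: exp_diff ring_distribs)
  qed
  finally show ?thesis .
qed

lemma standard_cauchy_eq: "standard_cauchy = density lborel (cauchy_density 1)"
  by (simp add: standard_cauchy_def cauchy_density_def[abs_def])

section \<open>Nonnegativity of the binomial Cauchy mixture\<close>

text \<open>Clearing denominators, the claim is \<open>(1 - \<alpha>) x\<^sup>2 - 2 x + 1 + (1 - \<alpha>) t\<^sup>2 \<ge> 0\<close>. The discriminant of
  this quadratic in \<open>x\<close> is nonpositive iff \<open>t \<ge> sqrt \<alpha> / (1 - \<alpha>)\<close>.\<close>

lemma cauchy_density_shift_le:
  assumes \<alpha>: "0 < \<alpha>" "\<alpha> < 1" and t: "sqrt \<alpha> / (1 - \<alpha>) \<le> t"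
  shows "\<alpha> * cauchy_density t (x - 1) \<le> cauchy_density t x"
proof -
  have t0: "t > 0" using \<alpha> t by (smt (verit) divide_pos_pos real_sqrt_gt_zero)
  have "sqrt \<alpha> \<le> t * (1 - \<alpha>)" using t \<alpha> by (simp add: field_simps)
  hence "(sqrt \<alpha>)\<^sup>2 \<le> (t * (1 - \<alpha>))\<^sup>2" using \<alpha> by (intro power_mono) auto
  hence "\<alpha> \<le> (1 - \<alpha>)\<^sup>2 * t\<^sup>2" using \<alpha> by (simp add: power_mult_distrib mult.commute)
  hence "0 \<le> ((1 - \<alpha>) * x - 1)\<^sup>2 + ((1 - \<alpha>)\<^sup>2 * t\<^sup>2 - \<alpha>)" by simp
  also have "\<dots> = (1 - \<alpha>) * (((x - 1)\<^sup>2 + t\<^sup>2) - \<alpha> * (x\<^sup>2 + t\<^sup>2))"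
    by (simp add: algebra_simps power2_eq_square)
  finally have "\<alpha> * (x\<^sup>2 + t\<^sup>2) \<le> (x - 1)\<^sup>2 + t\<^sup>2"
    using \<alpha> by (simp add: zero_le_mult_iff)
  moreover have "x\<^sup>2 + t\<^sup>2 > 0" "(x - 1)\<^sup>2 + t\<^sup>2 > 0" using t0 by (simp_all add: add_nonneg_pos)
  ultimately have "\<alpha> / ((x - 1)\<^sup>2 + t\<^sup>2) \<le> 1 / (x\<^sup>2 + t\<^sup>2)" by (simp add: field_simps)
  hence "(t / pi) * (\<alpha> / ((x - 1)\<^sup>2 + t\<^sup>2)) \<le> (t / pi) * (1 / (x\<^sup>2 + t\<^sup>2))"
    using t0 by (intro mult_left_mono) auto
  thus ?thesis by (simp add: cauchy_density_def mult_ac)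
qed

lemma cauchy_density_le: "t > 0 \<Longrightarrow> cauchy_density t x \<le> 1 / (pi * t)"
proof -
  assume t: "t > 0"
  have "cauchy_density t x \<le> t / (pi * t\<^sup>2)"
    unfolding cauchy_density_def using t by (intro divide_left_mono mult_left_mono) (auto simp: add_nonneg_pos)
  thus ?thesis using t by (simp add: power2_eq_square)
qed

lemma gbinomial_Suc_ratio:
  fixes t :: "'a :: field_char_0"
  shows "t gchoose Suc k = (t gchoose k) * (t - of_nat k) / of_nat (Suc k)"
  using gbinomial_mult_1[of t k] by (simp add: field_simps del: of_nat_Suc)

lemma gbinomial_of_real:
  "complex_of_real t gchoose k = complex_of_real (t gchoose k)"
  by (simp add: gbinomial_altdef_of_nat)

lemma gbinomial_nonneg:
  fixes t :: real
  assumes "0 \<le> t" "real k \<le> t + 1"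
  shows "0 \<le> t gchoose k"
  using assms(2) by (induction k) (auto simp: gbinomial_Suc_ratio)

lemma gbinomial_alternating:
  fixes t :: real
  assumes "0 \<le> t" "t \<le> real n" "0 \<le> t gchoose n"
  shows "0 \<le> (-1) ^ j * (t gchoose (n + j))"
    and "(-1) ^ Suc j * (t gchoose (n + Suc j)) \<le> (-1) ^ j * (t gchoose (n + j))"
proof -
  have rec: "(-1) ^ Suc j * (t gchoose (n + Suc j))
      = ((-1) ^ j * (t gchoose (n + j))) * ((real (n + j) - t) / real (Suc (n + j)))" for j
    by (simp add: gbinomial_Suc_ratio field_simps)
  show nn: "0 \<le> (-1) ^ j * (t gchoose (n + j))" for j
  proof (induction j)
    case (Suc j)
    have "0 \<le> (real (n + j) - t) / real (Suc (n + j))" using assms by simp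
    thus ?case unfolding rec using Suc by (rule mult_nonneg_nonneg[rotated])
  qed (use assms in simp)
  have "(real (n + j) - t) / real (Suc (n + j)) \<le> 1" using assms by simp
  thus "(-1) ^ Suc j * (t gchoose (n + Suc j)) \<le> (-1) ^ j * (t gchoose (n + j))"
    unfolding rec using nn by (rule mult_left_le)
qed

lemma summable_gbinomial_abs:
  fixes t \<alpha> :: real
  assumes "\<bar>\<alpha>\<bar> < 1"
  shows "summable (\<lambda>k. \<bar>(t gchoose k) * \<alpha> ^ k\<bar>)"
proof -
  have "summable (\<lambda>k. (t gchoose k) * ((1 + \<bar>\<alpha>\<bar>) / 2) ^ k)"
    using gen_binomial_real[of "(1 + \<bar>\<alpha>\<bar>) / 2" t] assms by (intro sums_summable) auto
  from powser_insidea[OF this, of \<alpha>] assms show ?thesis by simp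
qed

lemma summable_cauchy_mixture:
  assumes "t > 0" "summable (\<lambda>k. \<bar>c k\<bar>)"
  shows "summable (\<lambda>k. \<bar>c k * cauchy_density t (x - a k)\<bar>)"
proof (rule summable_comparison_test'[OF summable_mult2[OF assms(2)]])
  show "norm \<bar>c k * cauchy_density t (x - a k)\<bar> \<le> \<bar>c k\<bar> * (1 / (pi * t))" for k
    using cauchy_density_le[OF assms(1), of "x - a k"] cauchy_density_nonneg[OF assms(1), of "x - a k"]
    by (auto simp: abs_mult simp del: times_divide_eq_right intro!: mult_left_mono)
qed

lemma binomial_cauchy_mixture_nonneg:
  assumes \<alpha>: "0 < \<alpha>" "\<alpha> < 1" and t: "sqrt \<alpha> / (1 - \<alpha>) \<le> t"
  shows "0 \<le> (\<Sum>k. (t gchoose k) * \<alpha> ^ k * cauchy_density t (x - real k))"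
proof -
  have t0: "t > 0" using \<alpha> t by (smt (verit) divide_pos_pos real_sqrt_gt_zero)
  define f where "f k = (t gchoose k) * \<alpha> ^ k * cauchy_density t (x - real k)" for k
  have sf: "summable f"
    unfolding f_def
    by (rule summable_rabs_cancel, rule summable_cauchy_mixture[OF t0]) (use \<alpha> summable_gbinomial_abs in auto)
  \<comment> \<open>All coefficients up to the index \<open>n = floor t + 1\<close> are nonnegative; the alternating tail starts
    at \<open>n\<close>.\<close>
  define n where "n = Suc (nat \<lfloor>t\<rfloor>)"
  have n: "real n \<le> t + 1" "t \<le> real n" using t0 unfolding n_def by linarith+
  have nn: "0 \<le> t gchoose n" using gbinomial_nonneg[OF _ n(1)] t0 by simp
  define b where "b j = (-1) ^ j * (t gchoose (n + j))" for j
  define a where "a j = b j * (\<alpha> ^ (n + j) * cauchy_density t (x - real (n + j)))" for j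
  have b0: "0 \<le> b j" and b_dec: "b (Suc j) \<le> b j" for j
    unfolding b_def using gbinomial_alternating[OF less_imp_le[OF t0] n(2) nn, of j] by auto
  have fa: "f (j + n) = (-1) ^ j * a j" for j
    by (simp add: f_def a_def b_def add.commute mult_ac flip: power_mult_distrib)
  have a0: "0 \<le> a j" for j
    unfolding a_def using b0 \<alpha> cauchy_density_nonneg[OF t0] by simp
  have a_dec: "a (Suc j) \<le> a j" for j
  proof -
    have "\<alpha> * cauchy_density t (x - real (n + j) - 1) \<le> cauchy_density t (x - real (n + j))"
      by (rule cauchy_density_shift_le[OF \<alpha> t])
    hence "\<alpha> ^ (n + j) * (\<alpha> * cauchy_density t (x - real (n + j) - 1))
        \<le> \<alpha> ^ (n + j) * cauchy_density t (x - real (n + j))"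
      using \<alpha> by (intro mult_left_mono) auto
    thus ?thesis
      unfolding a_def using \<alpha> cauchy_density_nonneg[OF t0]
      by (intro mult_mono[OF b_dec _ b0]) (auto simp: algebra_simps)
  qed
  have sfa: "summable (\<lambda>j. (-1) ^ j * a j)"
    using sf summable_iff_shift[of f n] by (simp add: fa)
  have "(\<lambda>j. \<bar>(-1) ^ j * a j\<bar>) \<longlonglongrightarrow> 0"
    using summable_LIMSEQ_zero[OF sfa] by (rule tendsto_rabs_zero)
  hence "a \<longlonglongrightarrow> 0" using a0 by (simp add: abs_mult)
  from summable_Leibniz'(2)[OF this a0 a_dec, of 0] have "0 \<le> (\<Sum>j. (-1) ^ j * a j)" by simp
  moreover have "0 \<le> (\<Sum>k<n. f k)"
  proof (rule sum_nonneg)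
    fix k assume "k \<in> {..<n}"
    hence "0 \<le> t gchoose k" using n t0 by (intro gbinomial_nonneg) auto
    thus "0 \<le> f k" unfolding f_def using \<alpha> cauchy_density_nonneg[OF t0] by simp
  qed
  ultimately have "0 \<le> (\<Sum>k. f k)"
    using suminf_split_initial_segment[OF sf, of n] by (simp add: fa)
  thus ?thesis by (simp add: f_def)
qed

text \<open>The transform of a signed mixture of translated Cauchy densities, integrated term by term.\<close>

lemma fourier_cauchy_mixture:
  fixes c a :: "nat \<Rightarrow> real"
  assumes t: "t > 0" and c: "summable (\<lambda>k. \<bar>c k\<bar>)"
  defines "g \<equiv> \<lambda>x. \<Sum>k. c k * cauchy_density t (x - a k)"
  shows "has_bochner_integral lborel (\<lambda>x. complex_of_real (g x) * iexp (y * x))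
    ((\<Sum>k. of_real (c k) * iexp (y * a k)) * of_real (exp (- t * \<bar>y\<bar>)))"
proof -
  define f where "f k x = of_real (c k) * (of_real (cauchy_density t (x - a k)) * iexp (y * x))" for k x
  have f: "has_bochner_integral lborel (f k) (of_real (c k) * (iexp (y * a k) * of_real (exp (- t * \<bar>y\<bar>))))" for k
    unfolding f_def by (intro has_bochner_integral_mult_right fourier_cauchy_density[OF t])
  have norm_f: "norm (f k x) = \<bar>c k\<bar> * cauchy_density t (x - a k)" for k x
    using cauchy_density_nonneg[OF t] by (simp add: f_def norm_mult)
  have int1: "(LINT x|lborel. cauchy_density t (x - b)) = 1" for b
  proof -
    have "has_bochner_integral lborel (\<lambda>x. complex_of_real (cauchy_density t (x - b))) (of_real 1)"
      using fourier_cauchy_density[OF t, of b 0] by simp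
    thus ?thesis
      by (simp only: has_bochner_integral_iff integral_complex_of_real of_real_eq_iff)
  qed
  have s1: "AE x in lborel. summable (\<lambda>k. norm (f k x))"
    using summable_cauchy_mixture[OF t c] cauchy_density_nonneg[OF t] by (simp add: norm_f abs_mult)
  have s2: "summable (\<lambda>k. LINT x|lborel. norm (f k x))"
    using c by (simp add: norm_f int1)
  have fi: "integrable lborel (f k)" for k using f[of k] by (simp add: has_bochner_integral_iff)
  have gf: "(\<Sum>k. f k x) = of_real (g x) * iexp (y * x)" for x
  proof -
    have "summable (\<lambda>k. c k * cauchy_density t (x - a k))"
      by (rule summable_rabs_cancel[OF summable_cauchy_mixture[OF t c]])
    hence "(\<lambda>k. complex_of_real (c k * cauchy_density t (x - a k))) sums complex_of_real (g x)"
      unfolding g_def by (intro sums_of_real summable_sums)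
    from sums_mult2[OF this, of "iexp (y * x)"]
    have "(\<lambda>k. f k x) sums (of_real (g x) * iexp (y * x))"
      by (simp add: f_def mult.assoc)
    thus ?thesis by (simp add: sums_iff)
  qed
  have sc: "summable (\<lambda>k. of_real (c k) * iexp (y * a k))"
    by (rule summable_norm_cancel) (use c in \<open>simp add: norm_mult\<close>)
  have "(CLINT x|lborel. (\<Sum>k. f k x)) = (\<Sum>k. of_real (c k) * (iexp (y * a k) * of_real (exp (- t * \<bar>y\<bar>))))"
    using integral_suminf[OF fi s1 s2] has_bochner_integral_integral_eq[OF f] by simp
  also have "\<dots> = (\<Sum>k. of_real (c k) * iexp (y * a k)) * of_real (exp (- t * \<bar>y\<bar>))"
    using suminf_mult2[OF sc, of "of_real (exp (- t * \<bar>y\<bar>))"] by (simp add: mult.assoc)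
  finally show ?thesis
    using integrable_suminf[OF fi s1 s2] unfolding gf by (simp add: has_bochner_integral_iff)
qed

section \<open>The measure and its second characteristic\<close>

lemma char_standard_cauchy: "char standard_cauchy y = of_real (exp (- \<bar>y\<bar>))"
  and real_distribution_standard_cauchy: "real_distribution standard_cauchy"
proof -
  have four: "has_bochner_integral lborel (\<lambda>x. complex_of_real (cauchy_density 1 x) * iexp (y * x))
      (of_real (exp (- \<bar>y\<bar>)))" for y
    using fourier_cauchy_density[of 1 0 y] by simp
  note * = characteristic_function_of_density[OF _ _ four, folded standard_cauchy_eq]
  show "char standard_cauchy y = of_real (exp (- \<bar>y\<bar>))"
    using *(2) cauchy_density_nonneg[of 1] by simp
  show "real_distribution standard_cauchy"
    using *(1) cauchy_density_nonneg[of 1] by simp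
qed

lemma char_two_point_measure:
  assumes "0 < \<alpha>"
  shows "char (two_point_measure \<alpha>) y = (1 + of_real \<alpha> * iexp y) / of_real (1 + \<alpha>)"
proof -
  interpret real_distribution "two_point_measure \<alpha>"
    by (rule real_distribution_two_point_measure[OF assms])
  have em: "emeasure (two_point_measure \<alpha>) A =
      ennreal ((indicator A 0 + \<alpha> * indicator A 1) / (1 + \<alpha>))" if "A \<in> sets borel" for A
    using that assms
    by (simp add: two_point_measure_def emeasure_add_measure divide_inverse algebra_simps
        flip: ennreal_mult ennreal_plus ennreal_indicator)
  \<comment> \<open>The measure is concentrated on two points, so the integrand may be replaced by a simple function.\<close>
  have "AE x in two_point_measure \<alpha>. x \<in> {0, 1}"
    by (rule AE_I[where N = "UNIV - {0, 1}"]) (auto simp: em)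
  hence "char (two_point_measure \<alpha>) y
      = (CLINT x|two_point_measure \<alpha>. indicator {0} x *\<^sub>R 1 + indicator {1} x *\<^sub>R iexp y)"
    unfolding char_def by (intro integral_cong_AE) (auto elim!: eventually_mono)
  also have "\<dots> = (1 + of_real \<alpha> * iexp y) / of_real (1 + \<alpha>)"
    using assms by (simp add: measure_def em scaleR_conv_of_real add_divide_distrib)
  finally show ?thesis .
qed

text \<open>The setting of the theorem: the measure \<open>\<mu>\<close> and an explicit formula \<open>\<psi>\<close> for its second
  characteristic (\<open>second_characteristic_\<mu>\<close>).\<close>

locale cauchy_two_point =
  fixes \<alpha> :: real
  assumes \<alpha>: "0 < \<alpha>" "\<alpha> < 1"
begin

definition \<mu> :: "real measure" where
  "\<mu> = convolution standard_cauchy (two_point_measure \<alpha>)"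

definition \<psi> :: "real \<Rightarrow> complex" where
  "\<psi> y = Ln (1 + of_real \<alpha> * iexp y) - of_real (ln (1 + \<alpha>)) - of_real \<bar>y\<bar>"

lemma Re_one_plus_pos: "0 < Re (1 + of_real \<alpha> * iexp y)"
proof -
  have "\<alpha> * (-1) \<le> \<alpha> * cos y" using \<alpha> by (intro mult_left_mono) auto
  hence "0 < 1 + \<alpha> * cos y" using \<alpha> by linarith
  also have "\<dots> = Re (1 + of_real \<alpha> * iexp y)" by (simp add: Re_exp)
  finally show ?thesis .
qed

lemma one_plus_nonzero: "1 + of_real \<alpha> * iexp y \<noteq> 0"
  using Re_one_plus_pos[of y] by (metis zero_complex.simps(1) less_irrefl)

lemma real_distribution_\<mu>: "real_distribution \<mu>"
  unfolding \<mu>_def using \<alpha>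
  by (intro real_distribution_convolution real_distribution_standard_cauchy real_distribution_two_point_measure)

lemma char_\<mu>: "char \<mu> y = exp (\<psi> y)"
proof -
  have "exp (complex_of_real (ln (1 + \<alpha>))) = of_real (1 + \<alpha>)"
    using \<alpha> by (simp only: exp_of_real) simp
  hence "exp (\<psi> y) = (1 + of_real \<alpha> * iexp y) / of_real (1 + \<alpha>) / exp (of_real \<bar>y\<bar>)"
    using one_plus_nonzero[of y] by (simp add: \<psi>_def exp_diff)
  also have "\<dots> = char \<mu> y"
    unfolding \<mu>_def using \<alpha>
    by (simp add: char_convolution real_distribution_standard_cauchy real_distribution_two_point_measure
        char_standard_cauchy char_two_point_measure exp_minus flip: exp_of_real) (simp add: divide_inverse mult_ac)
  finally show ?thesis ..
qed

lemma admissible_\<mu>: "admissible \<mu>"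
  by (simp add: admissible_def real_distribution_\<mu> char_\<mu>)

lemma \<psi>_0: "\<psi> 0 = 0"
  using \<alpha> Ln_of_real[of "1 + \<alpha>"] by (simp add: \<psi>_def)

lemma continuous_on_\<psi>: "continuous_on A \<psi>"
proof -
  have "1 + of_real \<alpha> * iexp y \<notin> \<real>\<^sub>\<le>\<^sub>0" for y
    using Re_one_plus_pos[of y] by (auto simp: complex_nonpos_Reals_iff)
  thus ?thesis
    unfolding \<psi>_def[abs_def] by (intro continuous_intros) auto
qed

lemma second_characteristic_\<mu>: "second_characteristic \<mu> = \<psi>"
  unfolding second_characteristic_def
  by (rule the1_equality[OF ex1_second_characteristic[OF admissible_\<mu>]])
    (simp add: continuous_on_\<psi> \<psi>_0 char_\<mu>)

text \<open>The function \<open>exp (t \<psi>)\<close> is the transform of the mixture \<open>g\<close> of translated Cauchy densities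
  whose weights are the coefficients of the normalised binomial series.\<close>

lemma Lambda_superset:
  assumes t: "sqrt \<alpha> / (1 - \<alpha>) \<le> t"
  shows "t \<in> Lambda \<mu>"
proof -
  have t0: "t > 0" using \<alpha> t by (smt (verit) divide_pos_pos real_sqrt_gt_zero)
  define c where "c k = (1 + \<alpha>) powr (-t) * ((t gchoose k) * \<alpha> ^ k)" for k
  define g where "g x = (\<Sum>k. c k * cauchy_density t (x - real k))" for x
  have sc: "summable (\<lambda>k. \<bar>c k\<bar>)"
    unfolding c_def abs_mult[of "_ powr _"] using summable_gbinomial_abs \<alpha> by (intro summable_mult) auto
  have "(\<Sum>k. of_real (c k) * iexp (y * real k)) * of_real (exp (- t * \<bar>y\<bar>)) = exp (of_real t * \<psi> y)" for y
  proof -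
    have "(\<lambda>k. (of_real t gchoose k) * (of_real \<alpha> * iexp y) ^ k) sums
        (1 + of_real \<alpha> * iexp y) powr (of_real t)"
      using \<alpha> by (intro gen_binomial_complex) (simp add: norm_mult)
    hence "(\<lambda>k. of_real ((1 + \<alpha>) powr (-t)) * ((of_real t gchoose k) * (of_real \<alpha> * iexp y) ^ k)) sums
        (of_real ((1 + \<alpha>) powr (-t)) * (1 + of_real \<alpha> * iexp y) powr (of_real t))"
      by (rule sums_mult)
    also have "(\<lambda>k. of_real ((1 + \<alpha>) powr (-t)) * ((of_real t gchoose k) * (of_real \<alpha> * iexp y) ^ k))
        = (\<lambda>k. of_real (c k) * iexp (y * real k))"
    proof
      fix k
      have "iexp y ^ k = iexp (y * real k)"
        by (subst exp_of_nat_mult[symmetric]) (simp add: mult_ac)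
      thus "of_real ((1 + \<alpha>) powr (-t)) * ((of_real t gchoose k) * (of_real \<alpha> * iexp y) ^ k)
          = of_real (c k) * iexp (y * real k)"
        by (simp only: c_def gbinomial_of_real power_mult_distrib of_real_mult of_real_power mult.assoc)
    qed
    finally have "(\<Sum>k. of_real (c k) * iexp (y * real k)) =
        of_real ((1 + \<alpha>) powr (-t)) * (1 + of_real \<alpha> * iexp y) powr (of_real t)"
      by (simp add: sums_iff)
    also have "\<dots> * of_real (exp (- t * \<bar>y\<bar>)) = exp (of_real t * \<psi> y)"
    proof -
      have "of_real t * \<psi> y = of_real (- t * ln (1 + \<alpha>)) + of_real t * Ln (1 + of_real \<alpha> * iexp y)
          + of_real (- t * \<bar>y\<bar>)"
        by (simp add: \<psi>_def algebra_simps)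
      moreover have "(1 + \<alpha>) powr (- t) = exp (- t * ln (1 + \<alpha>))"
        using \<alpha> by (simp add: powr_def)
      moreover have "(1 + of_real \<alpha> * iexp y) powr (of_real t) = exp (of_real t * Ln (1 + of_real \<alpha> * iexp y))"
        using one_plus_nonzero[of y] by (simp add: powr_def)
      ultimately show ?thesis by (simp only: exp_add exp_of_real)
    qed
    finally show ?thesis .
  qed
  hence four: "has_bochner_integral lborel (\<lambda>x. complex_of_real (g x) * iexp (y * x)) (exp (of_real t * \<psi> y))" for y
    using fourier_cauchy_mixture[OF t0 sc, of real y] by (simp add: g_def)
  have [measurable]: "g \<in> borel_measurable borel"
    unfolding g_def[abs_def] by measurable
  have "0 \<le> g x" for x
  proof -
    have "summable (\<lambda>k. (t gchoose k) * \<alpha> ^ k * cauchy_density t (x - real k))"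
      by (rule summable_rabs_cancel, rule summable_cauchy_mixture[OF t0])
        (use \<alpha> summable_gbinomial_abs in auto)
    hence "g x = (1 + \<alpha>) powr (-t) * (\<Sum>k. (t gchoose k) * \<alpha> ^ k * cauchy_density t (x - real k))"
      unfolding g_def c_def by (subst suminf_mult[symmetric]) (simp_all add: mult_ac)
    thus ?thesis using binomial_cauchy_mixture_nonneg[OF \<alpha> t] by simp
  qed
  from characteristic_function_of_density(3)[OF _ this four] \<psi>_0 t0
  show ?thesis by (simp add: Lambda_def second_characteristic_\<mu>)
qed

end

section \<open>Failure of conditional positive definiteness\<close>

lemma tendsto_scaled_exp_minus_one:
  fixes a :: complex
  shows "(\<lambda>n. of_nat (Suc n) * (exp (of_real (1 / real (Suc n)) * a) - 1)) \<longlonglongrightarrow> a"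
proof -
  have "((\<lambda>h. exp (h * a)) has_field_derivative a) (at 0)"
    by (auto intro!: derivative_eq_intros)
  hence lim: "((\<lambda>h. (exp (h * a) - 1) / h) \<longlongrightarrow> a) (at 0)"
    by (simp add: DERIV_def)
  have "(\<lambda>n. complex_of_real (1 / real (Suc n))) \<longlonglongrightarrow> of_real 0"
    by (intro tendsto_of_real LIMSEQ_Suc lim_1_over_n)
  hence "filterlim (\<lambda>n. complex_of_real (1 / real (Suc n))) (at 0) sequentially"
    by (intro filterlim_atI) (auto simp del: of_nat_Suc)
  from filterlim_compose[OF lim this] show ?thesis
    by (simp add: mult.commute)
qed

text \<open>One half of Schoenberg's theorem. Since \<open>\<Sum>i. z i = 0\<close>, replacing \<open>exp (\<psi> / n)\<close> by
  \<open>n (exp (\<psi> / n) - 1)\<close> only scales the quadratic form, and the latter tends to \<open>\<psi>\<close>.\<close>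

lemma conditionally_positive_definite:
  fixes \<psi> :: "real \<Rightarrow> complex" and z :: "nat \<Rightarrow> complex" and y :: "nat \<Rightarrow> real"
  assumes cf: "\<And>n. n \<ge> 1 \<Longrightarrow> characteristic_function (\<lambda>y. exp (complex_of_real (1 / real n) * \<psi> y))"
    and z: "(\<Sum>i<m. z i) = 0"
  shows "0 \<le> Re (\<Sum>i<m. \<Sum>j<m. \<psi> (y i - y j) * z i * cnj (z j))"
proof -
  define E where "E n x = exp (complex_of_real (1 / real (Suc n)) * \<psi> x)" for n x
  define Q where "Q n = (\<Sum>i<m. \<Sum>j<m. of_nat (Suc n) * (E n (y i - y j) - 1) * z i * cnj (z j))" for n
  have zz: "(\<Sum>i<m. \<Sum>j<m. c * z i * cnj (z j)) = 0" for c
  proof -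
    have "(\<Sum>i<m. \<Sum>j<m. c * z i * cnj (z j)) = c * (\<Sum>i<m. z i) * cnj (\<Sum>j<m. z j)"
      by (simp add: sum_distrib_left sum_distrib_right mult_ac)
    thus ?thesis using z by simp
  qed
  have "0 \<le> Re (Q n)" for n
  proof -
    have "Q n = (\<Sum>i<m. \<Sum>j<m. of_nat (Suc n) * (E n (y i - y j) * z i * cnj (z j)) - of_nat (Suc n) * z i * cnj (z j))"
      unfolding Q_def by (intro sum.cong refl) (simp only: ring_distribs mult.assoc mult_1_left mult_1_right right_diff_distrib left_diff_distrib)
    also have "\<dots> = of_nat (Suc n) * (\<Sum>i<m. \<Sum>j<m. E n (y i - y j) * z i * cnj (z j))"
      by (simp only: sum_subtractf zz sum_distrib_left diff_zero)
    finally have Q: "Q n = of_nat (Suc n) * (\<Sum>i<m. \<Sum>j<m. E n (y i - y j) * z i * cnj (z j))" .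
    have "Re (Q n) = real (Suc n) * Re (\<Sum>i<m. \<Sum>j<m. E n (y i - y j) * z i * cnj (z j))"
      unfolding Q by (simp only: times_complex.simps complex_Re_of_nat complex_Im_of_nat)
    moreover have "0 \<le> Re (\<Sum>i<m. \<Sum>j<m. E n (y i - y j) * z i * cnj (z j))"
    proof -
      have "1 \<le> Suc n" by simp
      from cf[OF this] have "positive_definite (E n)"
        unfolding characteristic_function_def E_def[abs_def] by blast
      thus ?thesis unfolding positive_definite_def by blast
    qed
    ultimately show ?thesis by simp
  qed
  moreover have "Q \<longlonglongrightarrow> (\<Sum>i<m. \<Sum>j<m. \<psi> (y i - y j) * z i * cnj (z j))"
    unfolding Q_def E_def by (intro tendsto_intros tendsto_scaled_exp_minus_one)
  ultimately show ?thesis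
    by (intro tendsto_lowerbound[OF tendsto_Re]) auto
qed

text \<open>The contribution of \<open>|y|\<close> to the quadratic form grows only linearly in the number of points. The
  proof adds one row and one column at a time.\<close>

lemma alternating_sum_distance:
  "(\<Sum>i<2*m. \<Sum>j<2*m. (-1) ^ (i + j) * \<bar>real i - real j\<bar>) = - real (2 * m)"
proof -
  have A: "(\<Sum>j<Suc n. (-1) ^ (n + j)) = (if even n then 1 else 0 :: real)" for n
  proof (induction n)
    case (Suc n)
    have "(\<Sum>j<Suc (Suc n). (-1) ^ (Suc n + j)) = - (\<Sum>j<Suc n. (-1) ^ (n + j)) + (1 :: real)"
      by (subst sum.lessThan_Suc) (simp add: sum_negf del: sum.lessThan_Suc)
    thus ?case unfolding Suc by auto
  qed simp
  have U: "(\<Sum>j<n. (-1) ^ (n + j) * (real n - real j)) = (if even n then real n / 2 else - (real n + 1) / 2)" for n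
  proof (induction n)
    case (Suc n)
    have "(\<Sum>j<Suc n. (-1) ^ (Suc n + j) * (real (Suc n) - real j))
        = - (\<Sum>j<Suc n. (-1) ^ (n + j) * (real n - real j)) - (\<Sum>j<Suc n. (-1) ^ (n + j))"
      by (simp only: sum_negf[symmetric] sum_subtractf[symmetric]) (intro sum.cong refl, simp add: algebra_simps)
    also have "\<dots> = (if even (Suc n) then real (Suc n) / 2 else - (real (Suc n) + 1) / 2)"
      unfolding A using Suc by (simp add: field_simps)
    finally show ?case .
  qed simp
  have step: "(\<Sum>i<Suc n. \<Sum>j<Suc n. (-1) ^ (i + j) * \<bar>real i - real j\<bar>)
      = (\<Sum>i<n. \<Sum>j<n. (-1) ^ (i + j) * \<bar>real i - real j\<bar>) + 2 * (\<Sum>j<n. (-1) ^ (n + j) * (real n - real j))" for n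
  proof -
    have "(\<Sum>j<n. (-1) ^ (n + j) * \<bar>real n - real j\<bar>) = (\<Sum>j<n. (-1) ^ (n + j) * (real n - real j))"
      by (intro sum.cong) auto
    moreover have "(\<Sum>i<n. (-1) ^ (i + n) * \<bar>real i - real n\<bar>) = (\<Sum>j<n. (-1) ^ (n + j) * (real n - real j))"
      by (intro sum.cong) (auto simp: add.commute)
    ultimately show ?thesis by (simp add: sum.distrib)
  qed
  show ?thesis
  proof (induction m)
    case (Suc m)
    have "2 * Suc m = Suc (Suc (2 * m))" by simp
    thus ?case using Suc unfolding step[of "Suc (2 * m)"] step[of "2 * m"] U
      by (simp only: step U) (simp add: field_simps)
  qed simp
qed

text \<open>The contribution of the periodic part: the sum over a block of four consecutive columns is the
  same in every row.\<close>

lemma alternating_sum_4_periodic: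
  fixes K :: "real \<Rightarrow> real"
  assumes per: "\<And>d. K (d - 4) = K d"
  shows "(\<Sum>j<4*M. (-1) ^ (i + j) * K (real i - real j)) = real M * (K 0 - K 1 + K 2 - K 3)"
proof -
  define B where "B i M = (\<Sum>r<4. (-1) ^ (i + r) * K (real i - real (4 * M + r)))" for i M :: nat
  have B_eq: "B i M = (-1) ^ i * (K (real i) - K (real i - 1) + K (real i - 2) - K (real i - 3))" for i M
  proof -
    have "K (x - real (4 * M + r)) = K (x - real r)" for x r
    proof (induction M)
      case (Suc M)
      thus ?case using per[of "x - real (4 * M + r)"] by (simp add: algebra_simps)
    qed simp
    thus ?thesis by (simp add: B_def eval_nat_numeral algebra_simps)
  qed
  have "(-1) ^ i * (K (real i) - K (real i - 1) + K (real i - 2) - K (real i - 3)) = K 0 - K 1 + K 2 - K 3" for i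
  proof (induction i)
    case 0
    show ?case using per[of 1] per[of 2] per[of 3] by simp
  next
    case (Suc i)
    have "K (real i - 3) = K (real i + 1)" using per[of "real i + 1"] by simp
    thus ?case using Suc by (simp add: algebra_simps)
  qed
  hence B: "B i M = K 0 - K 1 + K 2 - K 3" for i M by (simp add: B_eq)
  show ?thesis
  proof (induction M)
    case (Suc M)
    have "(\<Sum>j<4 * Suc M. (-1) ^ (i + j) * K (real i - real j))
        = (\<Sum>j<4 * M. (-1) ^ (i + j) * K (real i - real j)) + B i M"
    proof -
      have 4: "4 * Suc M = Suc (Suc (Suc (Suc (4 * M))))" by simp
      have sum4: "(\<Sum>r<4. g r) = g 0 + g 1 + g 2 + g 3" for g :: "nat \<Rightarrow> real"
        by (simp add: eval_nat_numeral)
      show ?thesis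
        unfolding 4 B_def sum.lessThan_Suc sum4 by (simp add: power_add power_mult algebra_simps eval_nat_numeral)
    qed
    thus ?case using Suc B by (simp add: algebra_simps)
  qed simp
qed

context cauchy_two_point
begin

lemma Re_\<psi>: "Re (\<psi> y) = ln (1 + 2 * \<alpha> * cos y + \<alpha>\<^sup>2) / 2 - ln (1 + \<alpha>) - \<bar>y\<bar>"
proof -
  have "(cmod (1 + of_real \<alpha> * iexp y))\<^sup>2 = (1 + \<alpha> * cos y)\<^sup>2 + (\<alpha> * sin y)\<^sup>2"
    by (simp add: cmod_power2 Re_exp Im_exp)
  also have "\<dots> = 1 + 2 * \<alpha> * cos y + \<alpha>\<^sup>2 * ((sin y)\<^sup>2 + (cos y)\<^sup>2)"
    by algebra
  finally have sq: "(cmod (1 + of_real \<alpha> * iexp y))\<^sup>2 = 1 + 2 * \<alpha> * cos y + \<alpha>\<^sup>2" by simp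
  have "ln (1 + 2 * \<alpha> * cos y + \<alpha>\<^sup>2) = 2 * ln (cmod (1 + of_real \<alpha> * iexp y))"
    unfolding sq[symmetric] using one_plus_nonzero[of y] by (simp add: ln_realpow)
  thus ?thesis using one_plus_nonzero[of y] by (simp add: \<psi>_def)
qed

text \<open>The function \<open>K d\<close> is the real part of \<open>\<psi>\<close> at \<open>d pi / 2\<close> without the term \<open>-|y|\<close>; it has
  period 4 in \<open>d\<close>.\<close>

lemma ex_inverse_notin_Lambda: "\<exists>n\<ge>1. 1 / real n \<notin> Lambda \<mu>"
proof (rule ccontr)
  assume "\<not> ?thesis"
  hence cf: "characteristic_function (\<lambda>y. exp (complex_of_real (1 / real n) * \<psi> y))" if "n \<ge> 1" for n
    using that by (auto simp: Lambda_def second_characteristic_\<mu>)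
  define K where "K d = ln (1 + 2 * \<alpha> * cos (d * pi / 2) + \<alpha>\<^sup>2) / 2 - ln (1 + \<alpha>)" for d :: real
  define \<kappa> where "\<kappa> = K 0 - K 1 + K 2 - K 3"
  have per: "K (d - 4) = K d" for d
  proof -
    have "(d - 4) * pi / 2 = d * pi / 2 - 2 * pi" by (simp add: field_simps)
    moreover have "cos (d * pi / 2 - 2 * pi) = cos (d * pi / 2)"
      using cos_periodic[of "d * pi / 2 - 2 * pi"] by simp
    ultimately show ?thesis by (simp only: K_def)
  qed
  have "\<kappa> = ln (1 - \<alpha>) + ln (1 + \<alpha>) - ln (1 + \<alpha>\<^sup>2)"
  proof -
    have "1 + 2 * \<alpha> + \<alpha>\<^sup>2 = (1 + \<alpha>)\<^sup>2" "1 - 2 * \<alpha> + \<alpha>\<^sup>2 = (1 - \<alpha>)\<^sup>2"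
      by (simp_all add: power2_eq_square algebra_simps)
    moreover have "cos (3 * pi / 2) = 0" using cos_3over2_pi by (simp add: field_simps)
    ultimately show ?thesis
      using \<alpha> by (simp add: \<kappa>_def K_def ln_realpow)
  qed
  also have "\<dots> = ln (1 - \<alpha>\<^sup>2) - ln (1 + \<alpha>\<^sup>2)"
  proof -
    have "ln (1 - \<alpha>) + ln (1 + \<alpha>) = ln ((1 - \<alpha>) * (1 + \<alpha>))"
      using \<alpha> by (subst ln_mult) auto
    also have "(1 - \<alpha>) * (1 + \<alpha>) = 1 - \<alpha>\<^sup>2"
      by (simp add: power2_eq_square algebra_simps)
    finally show ?thesis by simp
  qed
  also have "\<dots> < 0"
  proof -
    have "\<alpha>\<^sup>2 < 1" "0 < \<alpha>\<^sup>2" using \<alpha> by (simp_all add: abs_square_less_1)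
    hence "ln (1 - \<alpha>\<^sup>2) < ln (1 + \<alpha>\<^sup>2)"
      by (intro ln_less_cancel_iff[THEN iffD2]) linarith+
    thus ?thesis by simp
  qed
  finally have \<kappa>: "\<kappa> < 0" .
  \<comment> \<open>The form will be \<open>2 M (pi + 2 M \<kappa>)\<close>, so \<open>M\<close> is chosen to make the bracket negative.\<close>
  obtain M :: nat where "pi / (- 2 * \<kappa>) < real M" using reals_Archimedean2 by blast
  hence M: "pi + 2 * real M * \<kappa> < 0" using \<kappa> by (simp add: field_simps)
  hence M0: "M > 0" using pi_gt_zero by (cases M) auto
  define z :: "nat \<Rightarrow> complex" where "z j = (-1) ^ j" for j
  define y where "y j = real j * pi / 2" for j
  have "(\<Sum>i<2*m. z i) = 0" for m
    by (induction m) (simp_all add: z_def)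
  from this[of "2 * M"] have "(\<Sum>i<4*M. z i) = 0" by simp
  from conditionally_positive_definite[OF cf this, of y]
  have "0 \<le> Re (\<Sum>i<4*M. \<Sum>j<4*M. \<psi> (y i - y j) * z i * cnj (z j))" by simp
  also have "\<dots> = (\<Sum>i<4*M. \<Sum>j<4*M. (-1) ^ (i + j) * Re (\<psi> (y i - y j)))"
  proof -
    have "Re (w * z i * cnj (z j)) = (-1) ^ (i + j) * Re w" for w i j
    proof -
      have "w * z i * cnj (z j) = of_real ((-1) ^ (i + j)) * w"
        by (simp add: z_def power_add)
      thus ?thesis by (simp only: Re_complex_of_real times_complex.simps Im_complex_of_real)
    qed
    thus ?thesis by simp
  qed
  also have "\<dots> = (\<Sum>i<4*M. \<Sum>j<4*M. (-1) ^ (i + j) * K (real i - real j))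
      - pi / 2 * (\<Sum>i<4*M. \<Sum>j<4*M. (-1) ^ (i + j) * \<bar>real i - real j\<bar>)"
  proof -
    have "Re (\<psi> (y i - y j)) = K (real i - real j) - pi / 2 * \<bar>real i - real j\<bar>" for i j
    proof -
      have diff: "y i - y j = (real i - real j) * pi / 2" by (simp add: y_def field_simps)
      show ?thesis unfolding diff Re_\<psi> K_def by (simp add: abs_mult)
    qed
    thus ?thesis
      by (simp add: right_diff_distrib sum_subtractf sum_distrib_left mult_ac)
  qed
  also have "\<dots> = real (4 * M) * (real M * \<kappa>) + pi / 2 * real (4 * M)"
    using alternating_sum_distance[of "2 * M"] by (simp add: alternating_sum_4_periodic[of K, OF per] \<kappa>_def)
  also have "\<dots> = 2 * real M * (pi + 2 * real M * \<kappa>)" by (simp add: algebra_simps)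
  also have "\<dots> < 0" using M M0 by (intro mult_pos_neg) auto
  finally show False by simp
qed

section \<open>Infinite divisibility and the threshold\<close>

lemma not_infinitely_divisible_\<mu>: "\<not> infinitely_divisible \<mu>"
  using ex_inverse_notin_Lambda inverse_in_Lambda_of_convolution_root[OF admissible_\<mu>]
  unfolding infinitely_divisible_def by blast

lemma interior_Lambda_\<mu>: "interior (Lambda \<mu>) \<noteq> {}"
proof -
  let ?t = "sqrt \<alpha> / (1 - \<alpha>)"
  have "{?t<..<?t + 1} \<subseteq> interior (Lambda \<mu>)"
    by (rule interior_maximal) (auto intro: Lambda_superset)
  thus ?thesis by (metis dense_order_class.dense greaterThanLessThan_iff less_add_one subset_empty empty_iff subsetD)
qed

lemma lambda1_\<mu>: "0 < lambda1 \<mu>" "lambda1 \<mu> < \<infinity>"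
proof -
  have eq: "lambda1 \<mu> = Inf (ereal ` {l. l > 0 \<and> {l..} \<subseteq> Lambda \<mu>})"
    using interior_Lambda_\<mu> by (simp add: lambda1_def)
  obtain n :: nat where n: "n \<ge> 1" "1 / real n \<notin> Lambda \<mu>"
    using ex_inverse_notin_Lambda by blast
  have "1 / real n < l" if "{l..} \<subseteq> Lambda \<mu>" for l
    using n(2) that by (meson atLeast_iff linorder_not_less subsetD)
  hence "ereal (1 / real n) \<le> lambda1 \<mu>"
    unfolding eq by (intro Inf_greatest) (auto intro: less_imp_le)
  moreover have "0 < ereal (1 / real n)" using n(1) by simp
  ultimately show "0 < lambda1 \<mu>" by (rule order.strict_trans2[rotated])
  have "sqrt \<alpha> / (1 - \<alpha>) > 0" using \<alpha> by simp
  hence "lambda1 \<mu> \<le> ereal (sqrt \<alpha> / (1 - \<alpha>))"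
    unfolding eq using Lambda_superset by (intro Inf_lower) auto
  thus "lambda1 \<mu> < \<infinity>" by (rule order.strict_trans1) simp
qed

end

theorem mainTheorem2:
  fixes \<alpha> :: real and \<nu> \<mu> :: "real measure"
  assumes "\<alpha> \<in> {0<..<1}"
    and "\<nu> = two_point_measure \<alpha>"
    and "\<mu> = convolution standard_cauchy \<nu>"
  shows "admissible \<mu> \<and> \<not> infinitely_divisible \<mu> \<and>
    {sqrt \<alpha> / (1 - \<alpha>)..} \<subseteq> Lambda \<mu> \<and>
    interior (Lambda \<mu>) \<noteq> {} \<and> 0 < lambda1 \<mu> \<and> lambda1 \<mu> < \<infinity>"
proof -
  interpret C: cauchy_two_point \<alpha>
    using assms(1) by unfold_locales auto
  have "\<mu> = C.\<mu>"
    using assms(2,3) by (simp add: C.\<mu>_def)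
  thus ?thesis
    using C.admissible_\<mu> C.not_infinitely_divisible_\<mu> C.interior_Lambda_\<mu> C.lambda1_\<mu> C.Lambda_superset
    by auto
qed

end
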